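(* Let $k\ge2$. Let $G$ be a $k$-uniform hypergraph on $n$ vertices, and let $u\in\mathbb{R}^n$ be an eigenvector of the Laplacian tensor $\mathcal{L}(G)$ corresponding to $\rho(\mathcal{L}(G))$, i.e. $u\neq 0$ and $(\mathcal{L}(G)u)_i=\rho(\mathcal{L}(G))\,u_i^{k-1}$ for all $i$. Let $H$ be a $d$-regular $k$-uniform hypergraph on $m$ vertices and let $\widetilde{G}=G\times H$ be the direct product of $G$ and $H$. Then $(k-1)!\,d\,\rho(\mathcal{L}(G))$ is an eigenvalue of $\mathcal{L}(\widetilde{G})$ with corresponding eigenvector $u\otimes e$, where $e=(1,1,\dots,1)^T\in\mathbb{R}^m$.
   Context: A $k$-uniform hypergraph $G=(V(G),E(G))$ has a finite vertex set $V(G)$ (identified with $[n]=\{1,\dots,n\}$) and an edge set $E(G)$ consisting of distinct $k$-element subsets of $V(G)$; hypergraphs are assumed to have at least one edge. The degree $d_i$ of a vertex $i$ is the number of edges containing $i$; $H$ is $d$-regular if every vertex of $H$ has degree $d$. The direct product $G\times H$ of two $k$-uniform hypergraphs has vertex set $V(G)\times V(H)$, and $\{(i_1,j_1),\dots,(i_k,j_k)\}$ is an edge of $G\times H$ if and only if $\{i_1,\dots,i_k\}\in E(G)$ and $\{j_1,\dots,j_k\}\in E(H)$. For $u\in\mathbb{R}^n$, $v\in\mathbb{R}^m$, $u\otimes v$ is the vector indexed by $[n]\times[m]$ with $(u\otimes v)_{(i,j)}=u_iv_j$. The adjacency tensor $\mathcal{A}(G)$ is the tensor of order $k$ and dimension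 $n$ with entries $a_{i_1\ldots i_k}=\frac{1}{(k-1)!}$ if $\{i_1,\dots,i_k\}\in E(G)$ and $0$ otherwise; $\mathcal{D}(G)$ is the diagonal tensor of order $k$ and dimension $n$ with diagonal entries $d_{i\ldots i}=d_i$ and all other entries $0$; the Laplacian tensor is $\mathcal{L}(G)=\mathcal{D}(G)-\mathcal{A}(G)$. For a tensor $\mathcal{T}=(t_{i_1\ldots i_k})$ of order $k$ and dimension $n$ and $x\in\mathbb{C}^n$, $(\mathcal{T}x)_i=\sum_{i_2,\dots,i_k=1}^n t_{ii_2\ldots i_k}x_{i_2}\cdots x_{i_k}$. A number $\lambda\in\mathbb{C}$ is an eigenvalue of $\mathcal{T}$ with eigenvector $0\ne x\in\mathbb{C}^n$ if $(\mathcal{T}x)_i=\lambda x_i^{k-1}$ for all $i$; the spectral radius $\rho(\mathcal{T})$ is the maximum of $|\lambda|$ over eigenvalues $\lambda$ of $\mathcal{T}$. *)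

theory Defs
  imports "HOL-Analysis.Analysis"
begin

text \<open>
  A hypergraph is given by its edge set; its vertex set is the whole finite type \<open>'v\<close>,
  so that \<open>n\<close> is \<open>CARD('v)\<close>, and the vertex set of a product is the type \<open>'v \<times> 'w\<close>.
\<close>

definition uniform_hypergraph :: "nat \<Rightarrow> 'v::finite set set \<Rightarrow> bool" where
  "uniform_hypergraph k E \<longleftrightarrow> E \<noteq> {} \<and> (\<forall>e\<in>E. card e = k)"

definition degree :: "'v::finite set set \<Rightarrow> 'v \<Rightarrow> nat" where
  "degree E i = card {e \<in> E. i \<in> e}"

definition regular_hypergraph :: "nat \<Rightarrow> 'v::finite set set \<Rightarrow> bool" where
  "regular_hypergraph d E \<longleftrightarrow> (\<forall>i. degree E i = d)"

text \<open>
  For \<open>P = {(i\<^sub>1,j\<^sub>1),\<dots>,(i\<^sub>k,j\<^sub>k)}\<close> the two projections are \<open>{i\<^sub>1,\<dots>,i\<^sub>k}\<close> and \<open>{j\<^sub>1,\<dots>,j\<^sub>k}\<close>.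
\<close>

definition direct_product ::
    "nat \<Rightarrow> 'v::finite set set \<Rightarrow> 'w::finite set set \<Rightarrow> ('v \<times> 'w) set set" where
  "direct_product k E F = {P. card P = k \<and> fst ` P \<in> E \<and> snd ` P \<in> F}"

definition tensor_product :: "real ^ 'n::finite \<Rightarrow> real ^ 'm::finite \<Rightarrow> real ^ ('n \<times> 'm)" where
  "tensor_product u v = (\<chi> p. u $ fst p * v $ snd p)"

definition complex_vec :: "real ^ 'n::finite \<Rightarrow> complex ^ 'n" where
  "complex_vec u = (\<chi> i. complex_of_real (u $ i))"

text \<open>
  A tensor of order \<open>k\<close> maps an index list \<open>[i\<^sub>1,\<dots>,i\<^sub>k]\<close> to the entry at that position; values at
  lists of other lengths are irrelevant.  The order is therefore passed explicitly.
\<close>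

type_synonym 'n tensor = "'n list \<Rightarrow> complex"

definition adjacency_tensor :: "nat \<Rightarrow> 'n::finite set set \<Rightarrow> 'n tensor" where
  "adjacency_tensor k E = (\<lambda>is. if set is \<in> E then 1 / fact (k - 1) else 0)"

definition degree_tensor :: "nat \<Rightarrow> 'n::finite set set \<Rightarrow> 'n tensor" where
  "degree_tensor k E =
     (\<lambda>is. if \<exists>i. is = replicate k i then of_nat (degree E (hd is)) else 0)"

definition laplacian_tensor :: "nat \<Rightarrow> 'n::finite set set \<Rightarrow> 'n tensor" where
  "laplacian_tensor k E = (\<lambda>is. degree_tensor k E is - adjacency_tensor k E is)"

definition tensor_apply :: "nat \<Rightarrow> 'n::finite tensor \<Rightarrow> complex ^ 'n \<Rightarrow> complex ^ 'n" where
  "tensor_apply k T x = (\<chi> i. \<Sum>js | length js = k - 1. T (i # js) * (\<Prod>j\<leftarrow>js. x $ j))"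

definition tensor_eigenvector ::
    "nat \<Rightarrow> 'n::finite tensor \<Rightarrow> complex \<Rightarrow> complex ^ 'n \<Rightarrow> bool" where
  "tensor_eigenvector k T \<mu> x \<longleftrightarrow>
     x \<noteq> 0 \<and> (\<forall>i. tensor_apply k T x $ i = \<mu> * (x $ i) ^ (k - 1))"

definition tensor_eigenvalue :: "nat \<Rightarrow> 'n::finite tensor \<Rightarrow> complex \<Rightarrow> bool" where
  "tensor_eigenvalue k T \<mu> \<longleftrightarrow> (\<exists>x. tensor_eigenvector k T \<mu> x)"

definition tensor_spectral_radius :: "nat \<Rightarrow> 'n::finite tensor \<Rightarrow> real" where
  "tensor_spectral_radius k T = (GREATEST r. \<exists>\<mu>. tensor_eigenvalue k T \<mu> \<and> r = cmod \<mu>)"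

end

theory Submission
  imports Defs "HOL-Combinatorics.Multiset_Permutations"
begin

text \<open>
  Up to the factor \<open>1 / (k - 1)!\<close>, the degree and the adjacency sum at \<open>i\<close> are sums over the
  orderings of \<open>A - {i}\<close> for the edges \<open>A\<close> containing \<open>i\<close>. A list of pairs completes \<open>(i, j)\<close> to
  an edge of the product exactly if its two projections complete \<open>i\<close> and \<open>j\<close> to edges of the
  factors. As \<open>u \<otimes> (1,\<dots>,1)\<close> ignores the second coordinate, both sums at \<open>(i, j)\<close> are those of \<open>G\<close>
  at \<open>i\<close> times the number \<open>d (k - 1)!\<close> of orderings around \<open>j\<close>, so the Laplacian is scaled by
  \<open>d (k - 1)!\<close>.
\<close>

text \<open>Exactly the index lists at which row \<open>i\<close> of the adjacency tensor is
  nonzero. Working with lists instead of edges lets products be handled by entrywise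
  projection.\<close>

definition completions :: "nat \<Rightarrow> 'v::finite set set \<Rightarrow> 'v \<Rightarrow> 'v list set" where
  "completions k E i = {js. length js = k - 1 \<and> set (i # js) \<in> E}"

lemma finite_lists_of_length [simp]: "finite {js :: 'v::finite list. length js = n}"
  using finite_lists_length_eq[of "UNIV :: 'v set" n] by simp

lemma finite_completions [simp]: "finite (completions k E i)"
  by (rule finite_subset[OF _ finite_lists_of_length[of "k - 1"]]) (auto simp: completions_def)

text \<open>The list \<open>i # js\<close> has length \<open>k\<close> and its set is an edge with
  \<open>k\<close> elements, so it has no repetitions and \<open>js\<close> lists the rest of that
  edge exactly once.\<close>

lemma completions_eq_UN_permutations_of_set:
  assumes "k \<ge> 1" and card: "\<forall>e\<in>E. card e = k"
  shows "completions k E i = (\<Union>e\<in>{e \<in> E. i \<in> e}. permutations_of_set (e - {i}))"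
proof (intro equalityI subsetI)
  fix js assume "js \<in> completions k E i"
  then have js: "length js = k - 1" "set (i # js) \<in> E" by (auto simp: completions_def)
  then have "distinct (i # js)"
    using card js(2) assms(1) by (intro card_distinct) auto
  then have "js \<in> permutations_of_set (set (i # js) - {i})"
    by (auto simp: permutations_of_set_def)
  with js show "js \<in> (\<Union>e\<in>{e \<in> E. i \<in> e}. permutations_of_set (e - {i}))"
    by fastforce
next
  fix js assume "js \<in> (\<Union>e\<in>{e \<in> E. i \<in> e}. permutations_of_set (e - {i}))"
  then obtain e where e: "e \<in> E" "i \<in> e" "set js = e - {i}" "distinct js"
    by (auto simp: permutations_of_set_def)
  then have "set (i # js) = e" by auto
  moreover have "length js = k - 1"
    using e card distinct_card[OF e(4)] by simp
  ultimately show "js \<in> completions k E i"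
    using e by (simp add: completions_def)
qed

text \<open>The union is disjoint because \<open>js\<close> determines its edge as
  \<open>insert i (set js)\<close>; each edge through \<open>i\<close> contributes the (k-1)!
  orderings of its remaining vertices.\<close>

lemma card_completions:
  assumes "k \<ge> 1" and card: "\<forall>e\<in>E. card e = k"
  shows "card (completions k E i) = degree E i * fact (k - 1)"
proof -
  have "card (completions k E i) = (\<Sum>e\<in>{e \<in> E. i \<in> e}. card (permutations_of_set (e - {i})))"
    unfolding completions_eq_UN_permutations_of_set[OF assms]
  proof (rule card_UN_disjoint)
    show "\<forall>e\<in>{e \<in> E. i \<in> e}. \<forall>f\<in>{e \<in> E. i \<in> e}. e \<noteq> f \<longrightarrow>
        permutations_of_set (e - {i}) \<inter> permutations_of_set (f - {i}) = {}"
      by (auto simp: permutations_of_set_def)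
  qed auto
  also have "\<dots> = (\<Sum>e\<in>{e \<in> E. i \<in> e}. fact (k - 1))"
    by (intro sum.cong) (use card in auto)
  finally show ?thesis
    by (simp add: degree_def)
qed

lemma tensor_apply_adjacency:
  "tensor_apply k (adjacency_tensor k E) x $ i =
     (\<Sum>js\<in>completions k E i. \<Prod>j\<leftarrow>js. x $ j) / fact (k - 1)"
proof -
  have "tensor_apply k (adjacency_tensor k E) x $ i =
      (\<Sum>js | length js = k - 1.
         if js \<in> completions k E i then (\<Prod>j\<leftarrow>js. x $ j) / fact (k - 1) else 0)"
    by (auto simp: tensor_apply_def adjacency_tensor_def completions_def intro!: sum.cong)
  also have "\<dots> = (\<Sum>js\<in>completions k E i. (\<Prod>j\<leftarrow>js. x $ j) / fact (k - 1))"
    by (subst sum.inter_restrict[symmetric]) (auto simp: completions_def intro!: sum.cong)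
  finally show ?thesis
    by (simp add: sum_divide_distrib)
qed

lemma tensor_apply_degree:
  assumes "k \<ge> 1"
  shows "tensor_apply k (degree_tensor k E) x $ i = of_nat (degree E i) * (x $ i) ^ (k - 1)"
proof -
  \<comment> \<open>A constant list with head \<open>i\<close> is constantly \<open>i\<close>, so a
    single term of the sum survives. For \<open>k = 0\<close> the truncated \<open>k - 1\<close>
    would break this at the empty list.\<close>
  have *: "(\<exists>i'. i # js = replicate k i') \<longleftrightarrow> js = replicate (k - 1) i" for js
    using assms by (cases k) auto
  have "tensor_apply k (degree_tensor k E) x $ i =
      (\<Sum>js | length js = k - 1.
         if js = replicate (k - 1) i then of_nat (degree E i) * (\<Prod>j\<leftarrow>js. x $ j) else 0)"
    by (simp only: tensor_apply_def degree_tensor_def vec_lambda_beta *, intro sum.cong) auto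
  also have "\<dots> = of_nat (degree E i) * (\<Prod>j\<leftarrow>replicate (k - 1) i. x $ j)"
    by (subst sum.delta) auto
  finally show ?thesis
    by simp
qed

lemma tensor_apply_laplacian:
  assumes "k \<ge> 1"
  shows "tensor_apply k (laplacian_tensor k E) x $ i =
    of_nat (degree E i) * (x $ i) ^ (k - 1)
      - (\<Sum>js\<in>completions k E i. \<Prod>j\<leftarrow>js. x $ j) / fact (k - 1)"
proof -
  have "tensor_apply k (laplacian_tensor k E) x $ i =
      tensor_apply k (degree_tensor k E) x $ i - tensor_apply k (adjacency_tensor k E) x $ i"
    by (simp add: tensor_apply_def laplacian_tensor_def left_diff_distrib sum_subtractf)
  then show ?thesis
    by (simp only: tensor_apply_degree[OF assms] tensor_apply_adjacency)
qed

text \<open>The projections of the vertex set are the sets of the projected lists. Its cardinality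
  is squeezed: at most \<open>k\<close> by the length of the list, at least \<open>k\<close> because
  its first projection is an edge of \<open>G\<close>.\<close>

lemma completions_direct_product_iff:
  assumes "k \<ge> 1" and card: "\<forall>e\<in>G. card e = k"
  shows "ps \<in> completions k (direct_product k G H) (i, j) \<longleftrightarrow>
    map fst ps \<in> completions k G i \<and> map snd ps \<in> completions k H j"
proof -
  let ?P = "set ((i, j) # ps)"
  have "card ?P = k" if "length ps = k - 1" "fst ` ?P \<in> G"
  proof (rule antisym)
    show "card ?P \<le> k" using card_length[of "(i, j) # ps"] that(1) assms(1) by simp
    show "k \<le> card ?P" using card that(2) card_image_le[of ?P fst] by simp
  qed
  then show ?thesis
    by (auto simp: completions_def direct_product_def)
qed

lemma bij_betw_zip_completions:
  assumes "k \<ge> 1" and "\<forall>e\<in>G. card e = k"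
  shows "bij_betw (\<lambda>(is, js). zip is js) (completions k G i \<times> completions k H j)
    (completions k (direct_product k G H) (i, j))"
proof (rule bij_betw_byWitness[where f' = "\<lambda>ps. (map fst ps, map snd ps)"])
  show "\<forall>ps\<in>completions k (direct_product k G H) (i, j).
      (case (map fst ps, map snd ps) of (is, js) \<Rightarrow> zip is js) = ps"
    by (simp add: zip_map_fst_snd)
  show "(\<lambda>(is, js). zip is js) ` (completions k G i \<times> completions k H j)
      \<subseteq> completions k (direct_product k G H) (i, j)"
  proof clarify
    fix "is" js assume "is \<in> completions k G i" "js \<in> completions k H j"
    \<comment> \<open>Equal lengths keep \<open>zip\<close> from truncating, so projecting recovers
      both lists.\<close>
    moreover from this have "length is = length js" by (simp add: completions_def)
    ultimately show "zip is js \<in> completions k (direct_product k G H) (i, j)"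
      by (simp add: completions_direct_product_iff[OF assms])
  qed
qed (auto simp: completions_direct_product_iff[OF assms], auto simp: completions_def)

text \<open>An edge through \<open>i\<close> and an edge through \<open>j\<close> yield (k-1)!
  product edges through \<open>(i, j)\<close>, one per bijection of their remaining vertices. The
  proof counts completions on both sides and cancels one factorial.\<close>

lemma degree_direct_product:
  assumes "k \<ge> 1" and G: "\<forall>e\<in>G. card e = k" and H: "\<forall>e\<in>H. card e = k"
  shows "degree (direct_product k G H) (i, j) = fact (k - 1) * degree G i * degree H j"
proof -
  have "degree (direct_product k G H) (i, j) * fact (k - 1) =
      card (completions k (direct_product k G H) (i, j))"
    by (rule card_completions[symmetric]) (use assms(1) in \<open>auto simp: direct_product_def\<close>)
  also have "\<dots> = card (completions k G i) * card (completions k H j)"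
    using bij_betw_same_card[OF bij_betw_zip_completions[OF assms(1) G, of i H j]]
    by (simp add: card_cartesian_product)
  also have "\<dots> = (fact (k - 1) * degree G i * degree H j) * fact (k - 1)"
    by (simp add: card_completions[OF assms(1) G] card_completions[OF assms(1) H])
  finally show ?thesis
    by simp
qed

text \<open>After splitting each list of pairs into its projections, the summand depends on the
  first one only, so the second merely contributes a count.\<close>

lemma sum_completions_direct_product:
  fixes x :: "complex ^ 'n::finite"
  assumes "k \<ge> 1" and "\<forall>e\<in>G. card e = k"
  shows "(\<Sum>ps\<in>completions k (direct_product k G H) (i, j). \<Prod>p\<leftarrow>ps. x $ fst p) =
    of_nat (card (completions k H j)) * (\<Sum>is\<in>completions k G i. \<Prod>i\<leftarrow>is. x $ i)"
proof -
  have "(\<Sum>ps\<in>completions k (direct_product k G H) (i, j). \<Prod>p\<leftarrow>ps. x $ fst p) =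
      (\<Sum>(is, js)\<in>completions k G i \<times> completions k H j. \<Prod>p\<leftarrow>zip is js. x $ fst p)"
    by (subst sum.reindex_bij_betw[OF bij_betw_zip_completions[OF assms], symmetric])
       (simp_all add: case_prod_unfold)
  also have "\<dots> = (\<Sum>(is, js)\<in>completions k G i \<times> completions k H j. \<Prod>i\<leftarrow>is. x $ i)"
  proof (intro sum.cong refl, clarify)
    fix "is" js assume "is \<in> completions k G i" "js \<in> completions k H j"
    then have "map fst (zip is js) = is" by (simp add: completions_def)
    then show "(\<Prod>p\<leftarrow>zip is js. x $ fst p) = (\<Prod>i\<leftarrow>is. x $ i)"
      by (metis (mono_tags, lifting) comp_apply map_eq_conv map_map)
  qed
  also have "\<dots> = of_nat (card (completions k H j)) * (\<Sum>is\<in>completions k G i. \<Prod>i\<leftarrow>is. x $ i)"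
    by (simp add: sum.cartesian_product[symmetric] sum_distrib_left)
  finally show ?thesis .
qed

text \<open>The degree part gains \<open>fact (k - 1) * degree H j\<close> and the adjacency part
  \<open>card (completions k H j)\<close>; these agree by \<open>card_completions\<close>, so the
  difference scales as a whole.\<close>

lemma tensor_apply_laplacian_direct_product:
  fixes x :: "complex ^ 'n::finite"
  assumes "k \<ge> 1" and G: "\<forall>e\<in>G. card e = k" and H: "\<forall>e\<in>H. card e = k"
  shows "tensor_apply k (laplacian_tensor k (direct_product k G H)) (\<chi> p. x $ fst p) $ (i, j) =
    fact (k - 1) * of_nat (degree H j) * tensor_apply k (laplacian_tensor k G) x $ i"
  using sum_completions_direct_product[OF assms(1) G, where x = x and H = H and i = i and j = j]
  by (simp add: tensor_apply_laplacian[OF assms(1)] degree_direct_product[OF assms]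
      card_completions[OF assms(1) H] right_diff_distrib)

text \<open>Regularity makes the scaling factor independent of \<open>j\<close>, so any eigenpair of
  \<open>G\<close> lifts; the theorem takes the spectral radius for \<open>\<mu>\<close>.\<close>

lemma tensor_eigenvector_laplacian_direct_product:
  fixes x :: "complex ^ 'n::finite"
  assumes "k \<ge> 1" and "\<forall>e\<in>G. card e = k" and "\<forall>e\<in>H. card e = k"
    and "regular_hypergraph d H"
    and "tensor_eigenvector k (laplacian_tensor k G) \<mu> x"
  shows "tensor_eigenvector k (laplacian_tensor k (direct_product k G H))
    (fact (k - 1) * of_nat d * \<mu>) (\<chi> p. x $ fst p)"
  using assms(4,5)
  by (auto simp: tensor_eigenvector_def regular_hypergraph_def vec_eq_iff
      tensor_apply_laplacian_direct_product[OF assms(1-3)])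

theorem theorem3p2:
  fixes k d :: nat
    and G :: "'n::finite set set" and H :: "'m::finite set set"
    and u :: "real ^ 'n"
  assumes "k \<ge> 2"
    and "uniform_hypergraph k G"
    and "tensor_eigenvector k (laplacian_tensor k G)
           (of_real (tensor_spectral_radius k (laplacian_tensor k G))) (complex_vec u)"
    and "uniform_hypergraph k H"
    and "regular_hypergraph d H"
  shows "tensor_eigenvalue k (laplacian_tensor k (direct_product k G H))
           (of_real (fact (k - 1) * real d * tensor_spectral_radius k (laplacian_tensor k G)))
       \<and> tensor_eigenvector k (laplacian_tensor k (direct_product k G H))
           (of_real (fact (k - 1) * real d * tensor_spectral_radius k (laplacian_tensor k G)))
           (complex_vec (tensor_product u (\<chi> j. 1)))"
proof -
  \<comment> \<open>Multiplying by entries 1 turns the tensor product into the pullback of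
    \<open>u\<close> along \<open>fst\<close>, the form of the lifted eigenvector.\<close>
  have "complex_vec (tensor_product u (\<chi> j. 1)) = (\<chi> p :: 'n \<times> 'm. complex_vec u $ fst p)"
    by (simp add: complex_vec_def tensor_product_def)
  moreover have "k \<ge> 1" "\<forall>e\<in>G. card e = k" "\<forall>e\<in>H. card e = k"
    using assms(1,2,4) by (auto simp: uniform_hypergraph_def)
  ultimately have "tensor_eigenvector k (laplacian_tensor k (direct_product k G H))
      (of_real (fact (k - 1) * real d * tensor_spectral_radius k (laplacian_tensor k G)))
      (complex_vec (tensor_product u (\<chi> j. 1)))"
    using tensor_eigenvector_laplacian_direct_product[OF _ _ _ assms(5,3)] by simp
  then show ?thesis
    by (auto simp: tensor_eigenvalue_def)
qed

end
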